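(* Let $P$ be the transition matrix of an irreducible, aperiodic, reversible Markov chain on $[d]$ with stationary distribution $\pi$, let $f:[d]\to[0,1]$, let $\alpha\in(0,1)$, and let $(X_n)_{n\ge0}$ be the chain started from an arbitrary distribution $\pi_0$. Let $r_N(\epsilon)=\epsilon^2\Big[\frac{N}{T_f(\epsilon/2)}-1\Big]$ for $\epsilon>0$. For any width $\epsilon_N\in r_N^{-1}\big([8\log(2/\alpha),\infty)\big)$, the set $$I_N^{\mathrm{func}}=\Big[\frac{1}{N-T_f(\epsilon_N/2)}\sum_{n=T_f(\epsilon_N/2)+1}^{N}f(X_n)\;\pm\;\epsilon_N\Big]$$ is a $1-\alpha$ confidence interval for the mean $\mu=\mathbb{E}_\pi[f]$.
   Context: With $\pi_n^{(i)}$ the law of $X_n$ given $X_0=i$, $d_f(p,q)=|\mathbb{E}_p[f]-\mathbb{E}_q[f]|$ and $\mathbb{N}=\{1,2,\dots\}$, the $f$-mixing time is $T_f(\delta)=\min\{n\in\mathbb{N} : \max_{i\in[d]}d_f(\pi_n^{(i)},\pi)\le\delta\}$. The notation $[a\pm b]$ means the interval $[a-b,a+b]$. A random interval $I$ is a $1-\alpha$ confidence interval for $\mu$ if $\mathbb{P}(\mu\in I)\ge1-\alpha$. $N$ is a positive integer and $\epsilon_N>0$ is deterministic. *)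

theory Defs
  imports "HOL-Probability.Probability"
begin

text \<open>
  The state space $[d]$ is a finite type \<open>'s\<close> with $d$ = \<open>CARD('s)\<close>. A transition matrix $P$ is a
  map from states to probability mass functions, with entries $P_{ij}$ = \<open>pmf (P i) j\<close>.
\<close>

text \<open>Row $i$ of $P^n$: the law of $X_n$ for the chain started at $X_0 = i$. It is defined for
  every \<open>i\<close>, also when the initial distribution gives \<open>i\<close> no mass; the lemma
  \<open>cond_prob_eq_nstep_law\<close> below identifies it with the conditional law given $X_0 = i$.\<close>

primrec nstep_law :: "('s \<Rightarrow> 's pmf) \<Rightarrow> 's \<Rightarrow> nat \<Rightarrow> 's pmf" where
  "nstep_law P i 0 = return_pmf i"
| "nstep_law P i (Suc n) = bind_pmf (nstep_law P i n) P"

definition irreducible_chain :: "('s \<Rightarrow> 's pmf) \<Rightarrow> bool" where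
  "irreducible_chain P \<longleftrightarrow> (\<forall>i j. \<exists>n. pmf (nstep_law P i n) j > 0)"

definition aperiodic_chain :: "('s \<Rightarrow> 's pmf) \<Rightarrow> bool" where
  "aperiodic_chain P \<longleftrightarrow> (\<forall>i. Gcd {n. n \<ge> 1 \<and> pmf (nstep_law P i n) i > 0} = 1)"

definition stationary_distribution :: "'s pmf \<Rightarrow> ('s \<Rightarrow> 's pmf) \<Rightarrow> bool" where
  "stationary_distribution p P \<longleftrightarrow> bind_pmf p P = p"

definition reversible_chain :: "'s pmf \<Rightarrow> ('s \<Rightarrow> 's pmf) \<Rightarrow> bool" where
  "reversible_chain p P \<longleftrightarrow> (\<forall>i j. pmf p i * pmf (P i) j = pmf p j * pmf (P j) i)"

locale markov_chain = prob_space M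
  for M :: "'a measure" and P :: "'s::finite \<Rightarrow> 's pmf" and \<pi>\<^sub>0 :: "'s pmf"
    and X :: "nat \<Rightarrow> 'a \<Rightarrow> 's" +
  assumes random_X: "X n \<in> measurable M (count_space UNIV)"
    and initial: "\<P>(\<omega> in M. X 0 \<omega> = i) = pmf \<pi>\<^sub>0 i"
    and markov: "\<P>(\<omega> in M. \<forall>k\<le>n. X k \<omega> = x k) > 0 \<Longrightarrow>
      \<P>(\<omega> in M. X (Suc n) \<omega> = j \<bar> \<forall>k\<le>n. X k \<omega> = x k) = pmf (P (x n)) j"

definition f_dist :: "('s \<Rightarrow> real) \<Rightarrow> 's pmf \<Rightarrow> 's pmf \<Rightarrow> real" where
  "f_dist f p q = \<bar>measure_pmf.expectation p f - measure_pmf.expectation q f\<bar>"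

definition f_mixing_time ::
    "('s::finite \<Rightarrow> 's pmf) \<Rightarrow> 's pmf \<Rightarrow> ('s \<Rightarrow> real) \<Rightarrow> real \<Rightarrow> nat" where
  "f_mixing_time P p f \<delta> = (LEAST n. n \<ge> 1 \<and> (MAX i. f_dist f (nstep_law P i n) p) \<le> \<delta>)"

definition r_fun ::
    "('s::finite \<Rightarrow> 's pmf) \<Rightarrow> 's pmf \<Rightarrow> ('s \<Rightarrow> real) \<Rightarrow> nat \<Rightarrow> real \<Rightarrow> real" where
  "r_fun P p f N \<epsilon> = \<epsilon>\<^sup>2 * (real N / real (f_mixing_time P p f (\<epsilon> / 2)) - 1)"

definition pm_interval :: "real \<Rightarrow> real \<Rightarrow> real set" where
  "pm_interval a b = {a - b..a + b}"

definition confidence_interval :: "'a measure \<Rightarrow> real \<Rightarrow> real \<Rightarrow> ('a \<Rightarrow> real set) \<Rightarrow> bool" where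
  "confidence_interval M c \<mu> I \<longleftrightarrow> \<P>(\<omega> in M. \<mu> \<in> I \<omega>) \<ge> c"

definition func_interval ::
    "('s::finite \<Rightarrow> 's pmf) \<Rightarrow> 's pmf \<Rightarrow> ('s \<Rightarrow> real) \<Rightarrow> (nat \<Rightarrow> 'a \<Rightarrow> 's) \<Rightarrow> nat \<Rightarrow> real \<Rightarrow> 'a \<Rightarrow> real set"
  where
  "func_interval P p f X N \<epsilon> \<omega> =
     (let T = f_mixing_time P p f (\<epsilon> / 2)
      in pm_interval (1 / (real N - real T) * (\<Sum>n = T + 1..N. f (X n \<omega>))) \<epsilon>)"

context markov_chain
begin

lemma measurable_X [measurable]: "X n \<in> measurable M (count_space UNIV)"
  by (rule random_X)

lemma prob_path_Suc:
  "\<P>(\<omega> in M. (\<forall>k\<le>n. X k \<omega> = x k) \<and> X (Suc n) \<omega> = j) =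
   \<P>(\<omega> in M. \<forall>k\<le>n. X k \<omega> = x k) * pmf (P (x n)) j"
proof (cases "\<P>(\<omega> in M. \<forall>k\<le>n. X k \<omega> = x k) > 0")
  case True
  with markov[OF True, of j] show ?thesis
    by (simp add: cond_prob_def field_simps conj_commute)
next
  case False
  then have z: "\<P>(\<omega> in M. \<forall>k\<le>n. X k \<omega> = x k) = 0"
    using measure_nonneg[of M "{\<omega> \<in> space M. \<forall>k\<le>n. X k \<omega> = x k}"] by linarith
  have "\<P>(\<omega> in M. (\<forall>k\<le>n. X k \<omega> = x k) \<and> X (Suc n) \<omega> = j) \<le> \<P>(\<omega> in M. \<forall>k\<le>n. X k \<omega> = x k)"
    by (rule finite_measure_mono) auto
  with z show ?thesis
    by (simp add: measure_le_0_iff)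
qed

lemma prob_start_Suc:
  "\<P>(\<omega> in M. X 0 \<omega> = i \<and> X n \<omega> = k \<and> X (Suc n) \<omega> = j) =
   \<P>(\<omega> in M. X 0 \<omega> = i \<and> X n \<omega> = k) * pmf (P k) j"
proof -
  define S where "S = {x \<in> PiE {..n} (\<lambda>_. UNIV :: 's set). x 0 = i \<and> x n = k}"
  have fin: "finite S"
    unfolding S_def by (rule finite_subset[OF _ finite_PiE[of "{..n}" "\<lambda>_. UNIV"]]) auto
  have split: "\<P>(\<omega> in M. X 0 \<omega> = i \<and> X n \<omega> = k \<and> Q \<omega>) =
      (\<Sum>x\<in>S. \<P>(\<omega> in M. (\<forall>m\<le>n. X m \<omega> = x m) \<and> Q \<omega>))"
    if [measurable]: "Measurable.pred M Q" for Q
  proof -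
    have eq: "{\<omega> \<in> space M. X 0 \<omega> = i \<and> X n \<omega> = k \<and> Q \<omega>} =
        (\<Union>x\<in>S. {\<omega> \<in> space M. (\<forall>m\<le>n. X m \<omega> = x m) \<and> Q \<omega>})" (is "?L = ?R")
    proof
      show "?L \<subseteq> ?R"
      proof
        fix \<omega> assume "\<omega> \<in> ?L"
        then show "\<omega> \<in> ?R"
          by (intro UN_I[of "restrict (\<lambda>m. X m \<omega>) {..n}"]) (auto simp: S_def)
      qed
      show "?R \<subseteq> ?L" by (auto simp: S_def)
    qed
    have "disjoint_family_on (\<lambda>x. {\<omega> \<in> space M. (\<forall>m\<le>n. X m \<omega> = x m) \<and> Q \<omega>}) S"
    proof (unfold disjoint_family_on_def, intro ballI impI)
      fix x y assume "x \<in> S" "y \<in> S" "x \<noteq> y"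
      then obtain m where "m \<le> n" "x m \<noteq> y m"
        unfolding S_def by (metis (mono_tags, lifting) PiE_ext atMost_iff mem_Collect_eq)
      then show "{\<omega> \<in> space M. (\<forall>m\<le>n. X m \<omega> = x m) \<and> Q \<omega>} \<inter>
          {\<omega> \<in> space M. (\<forall>m\<le>n. X m \<omega> = y m) \<and> Q \<omega>} = {}"
        by force
    qed
    then show ?thesis
      unfolding eq by (intro finite_measure_finite_Union fin) auto
  qed
  have "\<P>(\<omega> in M. X 0 \<omega> = i \<and> X n \<omega> = k \<and> X (Suc n) \<omega> = j) =
      (\<Sum>x\<in>S. \<P>(\<omega> in M. \<forall>m\<le>n. X m \<omega> = x m) * pmf (P k) j)"
    by (subst split) (auto simp: prob_path_Suc S_def intro!: sum.cong)
  also have "\<dots> = \<P>(\<omega> in M. X 0 \<omega> = i \<and> X n \<omega> = k) * pmf (P k) j"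
    using split[of "\<lambda>_. True"] by (simp add: sum_distrib_right)
  finally show ?thesis .
qed

lemma prob_start_eq: "\<P>(\<omega> in M. X 0 \<omega> = i \<and> X n \<omega> = j) = pmf \<pi>\<^sub>0 i * pmf (nstep_law P i n) j"
proof (induction n arbitrary: j)
  case 0
  show ?case
  proof (cases "i = j")
    case True
    then show ?thesis by (simp add: initial)
  next
    case False
    then have "{\<omega> \<in> space M. X 0 \<omega> = i \<and> X 0 \<omega> = j} = {}" by auto
    then have "\<P>(\<omega> in M. X 0 \<omega> = i \<and> X 0 \<omega> = j) = 0"
      by (simp only: measure_empty)
    with False show ?thesis by (simp add: indicator_def)
  qed
next
  case (Suc n)
  have eq: "{\<omega> \<in> space M. X 0 \<omega> = i \<and> X (Suc n) \<omega> = j} =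
      (\<Union>k. {\<omega> \<in> space M. X 0 \<omega> = i \<and> X n \<omega> = k \<and> X (Suc n) \<omega> = j})"
    by auto
  have "\<P>(\<omega> in M. X 0 \<omega> = i \<and> X (Suc n) \<omega> = j) =
      (\<Sum>k\<in>UNIV. \<P>(\<omega> in M. X 0 \<omega> = i \<and> X n \<omega> = k \<and> X (Suc n) \<omega> = j))"
    unfolding eq by (rule finite_measure_finite_Union) (auto simp: disjoint_family_on_def)
  also have "\<dots> = (\<Sum>k\<in>UNIV. pmf \<pi>\<^sub>0 i * pmf (nstep_law P i n) k * pmf (P k) j)"
    by (simp add: prob_start_Suc Suc.IH)
  also have "\<dots> = pmf \<pi>\<^sub>0 i * pmf (nstep_law P i (Suc n)) j"
    by (simp add: pmf_bind integral_measure_pmf[where A = UNIV] sum_distrib_left mult_ac)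
  finally show ?case .
qed

lemma cond_prob_eq_nstep_law:
  assumes "\<P>(\<omega> in M. X 0 \<omega> = i) > 0"
  shows "\<P>(\<omega> in M. X n \<omega> = j \<bar> X 0 \<omega> = i) = pmf (nstep_law P i n) j"
  using assms prob_start_eq[of i n j]
  by (simp add: cond_prob_def initial conj_commute)

end

end

theory Submission
  imports Defs
begin

text \<open>
  With \<open>T\<close> the mixing time at level \<open>\<epsilon> / 2\<close>, the value of \<open>f\<close> at time \<open>n + T\<close> has conditional
  mean at most \<open>\<mu> + \<epsilon> / 2\<close> given the path up to time \<open>n\<close>, whatever the path was. Hoeffding's lemma
  therefore bounds the moment generating function of the sum over times in one residue class modulo
  \<open>T\<close>, Jensen's inequality combines the classes, and Chernoff's bound with parameter \<open>\<epsilon> / T\<close> applied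
  to \<open>f\<close> and \<open>1 - f\<close> gives two tails of size \<open>exp (- \<epsilon>\<^sup>2 (N - T) / (4 T))\<close>. That the mixing time is
  attained at all follows from Doeblin's argument: some power of \<open>P\<close> has only positive entries, hence
  contracts oscillations.
\<close>

section \<open>Laws after n steps, stationarity and return times\<close>

lemma nstep_law_add:
  "nstep_law P i (m + n) = bind_pmf (nstep_law P i m) (\<lambda>k. nstep_law P k n)"
  by (induction n) (simp_all add: bind_return_pmf' bind_assoc_pmf)

lemma nstep_law_1: "nstep_law P i 1 = P i"
  by (simp add: bind_return_pmf)

lemma set_nstep_law_trans:
  assumes "k \<in> set_pmf (nstep_law P i m)" "j \<in> set_pmf (nstep_law P k n)"
  shows "j \<in> set_pmf (nstep_law P i (m + n))"
  using assms by (auto simp: nstep_law_add)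

lemma expectation_bind_finite:
  fixes p :: "'s::finite pmf" and g :: "'t::finite \<Rightarrow> real"
  shows "measure_pmf.expectation (bind_pmf p K) g =
    measure_pmf.expectation p (\<lambda>k. measure_pmf.expectation (K k) g)"
  by (subst pmf_expectation_bind[of UNIV]) (auto simp: integral_measure_pmf[of UNIV])

lemma bind_nstep_law_stationary:
  assumes "stationary_distribution \<pi> P"
  shows "bind_pmf \<pi> (\<lambda>i. nstep_law P i n) = \<pi>"
proof (induction n)
  case (Suc n)
  have "bind_pmf \<pi> (\<lambda>i. nstep_law P i (Suc n)) = bind_pmf (bind_pmf \<pi> (\<lambda>i. nstep_law P i n)) P"
    by (simp add: bind_assoc_pmf)
  with Suc assms show ?case
    by (simp add: stationary_distribution_def)
qed (simp add: bind_return_pmf')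

text \<open>Some state \<open>i\<close> carries stationary mass; irreducibility moves part of it to
  \<open>j\<close> in n steps, and n steps leave \<open>\<pi>\<close> unchanged. These positive
  weights allow detailed balance to reverse a step.\<close>

lemma set_pmf_stationary_UNIV:
  assumes "irreducible_chain P" "stationary_distribution \<pi> P"
  shows "set_pmf \<pi> = UNIV"
proof -
  have "j \<in> set_pmf \<pi>" for j
  proof -
    obtain i where i: "i \<in> set_pmf \<pi>"
      using set_pmf_not_empty[of \<pi>] by blast
    obtain n where "j \<in> set_pmf (nstep_law P i n)"
      using assms(1) by (auto simp: irreducible_chain_def pmf_positive_iff)
    with i show ?thesis
      by (subst bind_nstep_law_stationary[OF assms(2), of n, symmetric]) auto
  qed
  then show ?thesis by auto
qed

text \<open>Reversibility makes 2 a return time of every state, so that by aperiodicity there is also an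
  odd one; all larger numbers are then return times as well.\<close>

lemma eventually_return:
  assumes "irreducible_chain P" "aperiodic_chain P" "stationary_distribution \<pi> P"
    "reversible_chain \<pi> P"
  shows "\<exists>m. \<forall>n\<ge>m. i \<in> set_pmf (nstep_law P i n)"
proof -
  define R where "R = {n. i \<in> set_pmf (nstep_law P i n)}"
  have add: "m + n \<in> R" if "m \<in> R" "n \<in> R" for m n
    using that set_nstep_law_trans unfolding R_def by fastforce
  have two: "2 \<in> R"
  proof -
    obtain k where k: "k \<in> set_pmf (P i)"
      using set_pmf_not_empty[of "P i"] by blast
    \<comment> \<open>By detailed balance the product equals
      \<open>pmf \<pi> i * pmf (P i) k\<close>, so a step from \<open>i\<close> to \<open>k\<close>
      can be undone.\<close>
    have "pmf \<pi> k * pmf (P k) i > 0"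
      using assms(4) k set_pmf_stationary_UNIV[OF assms(1,3)]
      unfolding reversible_chain_def
      by (metis UNIV_I pmf_positive mult_pos_pos)
    then have "i \<in> set_pmf (P k)"
      by (auto simp: set_pmf_iff)
    then have "i \<in> set_pmf (nstep_law P i (1 + 1))"
      using k by (intro set_nstep_law_trans[of k]) (simp_all add: nstep_law_1 del: nstep_law.simps One_nat_def)
    then show ?thesis
      unfolding R_def by (simp only: mem_Collect_eq one_add_one)
  qed
  have zero: "0 \<in> R"
    by (simp add: R_def)
  have even: "2 * q \<in> R" for q
    by (induction q) (use zero add[OF two] in auto)
  have "\<exists>m\<in>R. odd m"
  proof (rule ccontr)
    assume "\<not> (\<exists>m\<in>R. odd m)"
    then have "2 dvd Gcd {n. n \<ge> 1 \<and> pmf (nstep_law P i n) i > 0}"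
      by (intro Gcd_greatest) (auto simp: R_def pmf_positive_iff)
    with assms(2) show False
      by (simp add: aperiodic_chain_def)
  qed
  then obtain m where m: "m \<in> R" "odd m" by blast
  have "n \<in> R" if "n \<ge> m" for n
  proof (cases "even n")
    case True
    then show ?thesis using even[of "n div 2"] by simp
  next
    case False
    with m(2) that have "n = m + 2 * ((n - m) div 2)" by simp
    then show ?thesis using add[OF m(1) even] by metis
  qed
  then show ?thesis by (auto simp: R_def)
qed

section \<open>Minorisation, contraction of oscillations, existence of the mixing time\<close>

text \<open>Doeblin's condition: finitely many pairs of states admit a common time at which all
  transitions are possible, and finitely many positive entries have a positive minimum.\<close>

lemma nstep_law_minorised:
  fixes P :: "'s::finite \<Rightarrow> 's pmf"
  assumes "irreducible_chain P" "aperiodic_chain P" "stationary_distribution \<pi> P"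
    "reversible_chain \<pi> P"
  shows "\<exists>n\<ge>1. \<exists>c>0. \<forall>i j. c \<le> pmf (nstep_law P i n) j"
proof -
  have "\<exists>m. \<forall>n\<ge>m. j \<in> set_pmf (nstep_law P i n)" for i j
  proof -
    obtain m where m: "\<And>n. n \<ge> m \<Longrightarrow> i \<in> set_pmf (nstep_law P i n)"
      using eventually_return[OF assms] by blast
    obtain k where k: "j \<in> set_pmf (nstep_law P i k)"
      using assms(1) by (auto simp: irreducible_chain_def pmf_positive_iff)
    \<comment> \<open>The first \<open>n - k\<close> steps return to \<open>i\<close>, the last
      \<open>k\<close> lead to \<open>j\<close>.\<close>
    have "j \<in> set_pmf (nstep_law P i n)" if "n \<ge> m + k" for n
      using set_nstep_law_trans[OF m k, of "n - k"] that by simp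
    then show ?thesis by blast
  qed
  then have "\<forall>i j. \<exists>m. \<forall>n\<ge>m. j \<in> set_pmf (nstep_law P i n)"
    by blast
  then obtain K where K: "\<forall>i j. \<forall>n\<ge>K i j. j \<in> set_pmf (nstep_law P i n)"
    by (subst (asm) choice_iff, subst (asm) choice_iff) blast
  \<comment> \<open>The sum dominates each threshold \<open>K i j\<close>; \<open>Suc\<close>
    secures n \<ge> 1.\<close>
  define n where "n = Suc (\<Sum>(i, j)\<in>UNIV. K i j)"
  have "K i j \<le> n" for i j
    unfolding n_def using member_le_sum[of "(i, j)" UNIV "\<lambda>(i, j). K i j"] by (simp add: le_SucI)
  then have pos: "pmf (nstep_law P i n) j > 0" for i j
    by (simp add: K pmf_positive)
  define c where "c = Min (range (\<lambda>(i, j). pmf (nstep_law P i n) j))"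
  have "c \<le> pmf (nstep_law P i n) j" for i j
    unfolding c_def by (rule Min_le) (auto intro: rev_image_eqI[of "(i, j)"])
  moreover have "c > 0"
    unfolding c_def by (subst Min_gr_iff) (auto simp: pos)
  moreover have "n \<ge> 1"
    by (simp add: n_def)
  ultimately show ?thesis
    by blast
qed

text \<open>The gap between \<open>b\<close> and the mean is an average of the nonnegative numbers
  \<open>b - h i\<close>, to which the state \<open>j\<close> alone contributes at least
  \<open>c * (b - h j)\<close>.\<close>

lemma expectation_bounds_minorised:
  fixes p :: "'s::finite pmf" and h :: "'s \<Rightarrow> real"
  assumes "\<And>i. h i \<in> {a..b}" "c \<le> pmf p j"
  shows "measure_pmf.expectation p h \<le> b - c * (b - h j)"
    and "measure_pmf.expectation p h \<ge> a"
proof -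
  have int: "integrable (measure_pmf p) g" for g :: "'s \<Rightarrow> real"
    by (rule integrable_measure_pmf_finite) simp
  have "c * (b - h j) \<le> pmf p j * (b - h j)"
    using assms by (intro mult_right_mono) auto
  also have "\<dots> \<le> (\<Sum>i\<in>UNIV. pmf p i * (b - h i))"
    using assms(1) by (intro member_le_sum) auto
  also have "\<dots> = b - measure_pmf.expectation p h"
    by (simp add: integral_measure_pmf[of UNIV] algebra_simps sum_subtractf
        flip: sum_distrib_left) (simp add: sum_pmf_eq_1)
  finally show "measure_pmf.expectation p h \<le> b - c * (b - h j)" by simp
  show "measure_pmf.expectation p h \<ge> a"
    using assms(1) int by (intro measure_pmf.integral_ge_const) auto
qed

text \<open>Each block of \<open>n\<close> steps replaces a function by averages of it that give its
  minimiser weight at least \<open>c\<close>. The lower bound stays and the upper one drops by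
  \<open>c\<close> times the spread, so the spread shrinks by the factor
  \<open>1 - c\<close>.\<close>

lemma nstep_law_oscillation:
  fixes P :: "'s::finite \<Rightarrow> 's pmf" and f :: "'s \<Rightarrow> real"
  assumes c: "\<And>i j. c \<le> pmf (nstep_law P i n) j" "c \<ge> 0" and f: "\<And>i. f i \<in> {u..v}"
  shows "\<exists>a b. b - a \<le> (1 - c) ^ k * (v - u) \<and>
    (\<forall>i. measure_pmf.expectation (nstep_law P i (n * k)) f \<in> {a..b})"
proof (induction k)
  case 0
  show ?case
    using f by (intro exI[of _ u] exI[of _ v]) simp
next
  case (Suc k)
  define h where "h i = measure_pmf.expectation (nstep_law P i (n * k)) f" for i
  from Suc obtain a b where ab: "b - a \<le> (1 - c) ^ k * (v - u)" "\<And>i. h i \<in> {a..b}"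
    by (auto simp: h_def)
  have "Min (range h) \<in> range h" "Max (range h) \<in> range h"
    by (simp_all del: Min_in Max_in add: Min_in Max_in)
  then obtain j l where j: "h j = Min (range h)" and l: "h l = Max (range h)"
    by (metis imageE)
  have h: "h i \<in> {h j..h l}" for i
    by (simp add: j l)
  \<comment> \<open>The new block comes first: \<open>h\<close> is evaluated at the state reached
    after \<open>n\<close> steps.\<close>
  have eq: "measure_pmf.expectation (nstep_law P i (n * Suc k)) f =
      measure_pmf.expectation (nstep_law P i n) h" for i
    by (simp add: nstep_law_add expectation_bind_finite h_def[abs_def])
  have "1 - c \<ge> 0"
    using c(1)[of j j] pmf_le_1[of "nstep_law P j n" j] by linarith
  then have "(1 - c) * (h l - h j) \<le> (1 - c) * ((1 - c) ^ k * (v - u))"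
    using ab(1) ab(2)[of l] ab(2)[of j] by (intro mult_left_mono) auto
  then have "(h l - c * (h l - h j)) - h j \<le> (1 - c) ^ Suc k * (v - u)"
    by (simp add: algebra_simps)
  moreover have "\<forall>i. measure_pmf.expectation (nstep_law P i (n * Suc k)) f
      \<in> {h j..h l - c * (h l - h j)}"
    unfolding eq using expectation_bounds_minorised[of h "h j" "h l", OF h c(1)] by auto
  ultimately show ?case by blast
qed

text \<open>By stationarity the mean under \<open>\<pi>\<close> is an average of the means after
  \<open>n * k\<close> steps, so it lies in the same short interval as each of them.\<close>

lemma ex_f_dist_le:
  fixes P :: "'s::finite \<Rightarrow> 's pmf" and f :: "'s \<Rightarrow> real"
  assumes "irreducible_chain P" "aperiodic_chain P" "stationary_distribution \<pi> P"
    "reversible_chain \<pi> P" "\<delta> > 0"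
  shows "\<exists>n\<ge>1. \<forall>i. f_dist f (nstep_law P i n) \<pi> \<le> \<delta>"
proof -
  obtain n c where n: "n \<ge> 1" and c: "c > 0" "\<And>i j. c \<le> pmf (nstep_law P i n) j"
    using nstep_law_minorised[OF assms(1-4)] by blast
  define u where "u = Min (range f)"
  define v where "v = Max (range f)"
  have f: "f i \<in> {u..v}" for i
    by (simp add: u_def v_def)
  have "\<exists>k\<ge>1. (1 - c) ^ k * (v - u) \<le> \<delta>"
  proof -
    have "1 - c \<ge> 0" for i :: 's
      using c(2)[of i i] pmf_le_1[of "nstep_law P i n" i] by linarith
    then have "(\<lambda>k. (1 - c) ^ k * (v - u)) \<longlonglongrightarrow> 0 * (v - u)"
      using c(1) by (intro tendsto_mult_right LIMSEQ_power_zero) simp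
    then have "eventually (\<lambda>k. (1 - c) ^ k * (v - u) < \<delta>) sequentially"
      using assms(5) by (intro order_tendstoD(2)[of _ "0 * (v - u)"]) auto
    then have "eventually (\<lambda>k. k \<ge> 1 \<and> (1 - c) ^ k * (v - u) < \<delta>) sequentially"
      using eventually_ge_at_top by (intro eventually_conj)
    then show ?thesis
      using eventually_happens'[OF sequentially_bot] less_imp_le by blast
  qed
  then obtain k where k: "k \<ge> 1" "(1 - c) ^ k * (v - u) \<le> \<delta>" by blast
  obtain a b where ab: "b - a \<le> (1 - c) ^ k * (v - u)"
      "\<And>i. measure_pmf.expectation (nstep_law P i (n * k)) f \<in> {a..b}"
    using nstep_law_oscillation[of c P n f u v k] c f by auto
  have "f_dist f (nstep_law P i (n * k)) \<pi> \<le> \<delta>" for i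
  proof -
    have "measure_pmf.expectation \<pi> f =
        measure_pmf.expectation \<pi> (\<lambda>i. measure_pmf.expectation (nstep_law P i (n * k)) f)"
      by (simp add: bind_nstep_law_stationary[OF assms(3)] flip: expectation_bind_finite)
    \<comment> \<open>With minorisation constant 0 only the bounds \<open>a\<close> and
      \<open>b\<close> remain, so any state, here \<open>undefined\<close>, can be named.\<close>
    also have "\<dots> \<in> {a..b}"
      using expectation_bounds_minorised[OF ab(2), of 0 \<pi> undefined] by simp
    finally show ?thesis
      using ab(1) ab(2)[of i] k(2) by (auto simp: f_dist_def)
  qed
  moreover have "n * k \<ge> 1"
    using n k(1) by simp
  ultimately show ?thesis by blast
qed

text \<open>The \<open>LEAST\<close> in the mixing time has its defining property because
  \<open>ex_f_dist_le\<close> supplies a candidate.\<close>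

lemma f_mixing_time_props:
  fixes P :: "'s::finite \<Rightarrow> 's pmf" and f :: "'s \<Rightarrow> real"
  assumes "irreducible_chain P" "aperiodic_chain P" "stationary_distribution \<pi> P"
    "reversible_chain \<pi> P" "\<delta> > 0"
  shows "f_mixing_time P \<pi> f \<delta> \<ge> 1"
    and "f_dist f (nstep_law P i (f_mixing_time P \<pi> f \<delta>)) \<pi> \<le> \<delta>"
proof -
  have "\<exists>n\<ge>1. (MAX i. f_dist f (nstep_law P i n) \<pi>) \<le> \<delta>"
    using ex_f_dist_le[OF assms] by (simp add: Max_le_iff)
  then have *: "f_mixing_time P \<pi> f \<delta> \<ge> 1 \<and>
      (MAX i. f_dist f (nstep_law P i (f_mixing_time P \<pi> f \<delta>)) \<pi>) \<le> \<delta>"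
    unfolding f_mixing_time_def by (rule LeastI_ex)
  show "f_mixing_time P \<pi> f \<delta> \<ge> 1"
    using * by blast
  show "f_dist f (nstep_law P i (f_mixing_time P \<pi> f \<delta>)) \<pi> \<le> \<delta>"
    using conjunct2[OF *] by (simp add: Max_le_iff)
qed

section \<open>Functionals of a path up to a fixed time, and the Markov property\<close>

text \<open>Stands in for measurability with respect to the first coordinates. Functionals take
  whole sequences, so the horizon can grow without a change of type.\<close>

definition depends_upto :: "nat \<Rightarrow> ((nat \<Rightarrow> 's) \<Rightarrow> real) \<Rightarrow> bool" where
  "depends_upto n h \<longleftrightarrow> (\<forall>x y. (\<forall>k\<le>n. x k = y k) \<longrightarrow> h x = h y)"

lemma depends_upto_mono: "depends_upto m h \<Longrightarrow> m \<le> n \<Longrightarrow> depends_upto n h"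
  by (auto simp: depends_upto_def)

lemma depends_upto_coordinate: "k \<le> n \<Longrightarrow> depends_upto n (\<lambda>x. g (x k))"
  by (auto simp: depends_upto_def)

lemma depends_upto_mult:
  "depends_upto n g \<Longrightarrow> depends_upto n h \<Longrightarrow> depends_upto n (\<lambda>x. g x * h x)"
  unfolding depends_upto_def by metis

lemma depends_upto_sum:
  "(\<And>a. a \<in> A \<Longrightarrow> depends_upto n (g a)) \<Longrightarrow> depends_upto n (\<lambda>x. \<Sum>a\<in>A. g a x)"
  unfolding depends_upto_def by (metis (no_types, lifting) sum.cong)

lemma depends_upto_comp: "depends_upto n h \<Longrightarrow> depends_upto n (\<lambda>x. g (h x))"
  unfolding depends_upto_def by metis

context markov_chain
begin

text \<open>Finitely many path prefixes partition the space into cylinders, on each of which the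
  functional is constant. Integrals thus reduce to the path probabilities of
  \<open>prob_path_Suc\<close>.\<close>

lemma path_function_eq_sum:
  assumes "depends_upto n h" "\<omega> \<in> space M"
  shows "h (\<lambda>k. X k \<omega>) = (\<Sum>x\<in>PiE {..n} (\<lambda>_. UNIV).
    h x * indicator {\<omega> \<in> space M. \<forall>k\<le>n. X k \<omega> = x k} \<omega>)"
proof -
  let ?S = "PiE {..n} (\<lambda>_. UNIV :: 's set)"
  \<comment> \<open>Restriction sets the path to \<open>undefined\<close> after time
    \<open>n\<close>, as membership in \<open>PiE\<close> demands; \<open>h\<close> does not see the
    change.\<close>
  define y where "y = restrict (\<lambda>k. X k \<omega>) {..n}"
  have fin: "finite ?S"
    by (rule finite_PiE) auto
  have "y \<in> ?S"
    by (simp add: y_def)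
  have "h x * indicator {\<omega> \<in> space M. \<forall>k\<le>n. X k \<omega> = x k} \<omega> = (if x = y then h y else 0)"
    if "x \<in> ?S" for x
  proof (cases "\<forall>k\<le>n. X k \<omega> = x k")
    case True
    then have "x = y"
      using that \<open>y \<in> ?S\<close> by (intro PiE_ext) (auto simp: y_def)
    with True assms(2) show ?thesis by simp
  next
    case False
    then show ?thesis by (auto simp: y_def)
  qed
  then have "(\<Sum>x\<in>?S. h x * indicator {\<omega> \<in> space M. \<forall>k\<le>n. X k \<omega> = x k} \<omega>) = h y"
    using fin \<open>y \<in> ?S\<close> by simp
  also have "h y = h (\<lambda>k. X k \<omega>)"
    using assms(1) unfolding depends_upto_def by (simp add: y_def)
  finally show ?thesis ..
qed

lemma integrable_path_function:
  assumes "depends_upto n h"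
  shows "integrable M (\<lambda>\<omega>. h (\<lambda>k. X k \<omega>))"
proof -
  have "integrable M (\<lambda>\<omega>. \<Sum>x\<in>PiE {..n} (\<lambda>_. UNIV).
      h x * indicator {\<omega> \<in> space M. \<forall>k\<le>n. X k \<omega> = x k} \<omega>)"
    by (intro Bochner_Integration.integrable_sum integrable_mult_right integrable_real_indicator)
      (auto simp: less_top[symmetric])
  then show ?thesis
    by (subst Bochner_Integration.integrable_cong[OF refl path_function_eq_sum[OF assms]])
qed

lemma expectation_path_function_indicator:
  assumes "depends_upto n h" and [measurable]: "Measurable.pred M Q"
  shows "expectation (\<lambda>\<omega>. h (\<lambda>k. X k \<omega>) * indicator {\<omega> \<in> space M. Q \<omega>} \<omega>) =
    (\<Sum>x\<in>PiE {..n} (\<lambda>_. UNIV). h x * \<P>(\<omega> in M. (\<forall>k\<le>n. X k \<omega> = x k) \<and> Q \<omega>))"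
proof -
  have "expectation (\<lambda>\<omega>. h (\<lambda>k. X k \<omega>) * indicator {\<omega> \<in> space M. Q \<omega>} \<omega>) =
    expectation (\<lambda>\<omega>. \<Sum>x\<in>PiE {..n} (\<lambda>_. UNIV).
      h x * indicator {\<omega> \<in> space M. (\<forall>k\<le>n. X k \<omega> = x k) \<and> Q \<omega>} \<omega>)"
    by (rule Bochner_Integration.integral_cong[OF refl])
      (auto simp: path_function_eq_sum[OF assms(1)] indicator_def intro!: sum.cong)
  also have "\<dots> = (\<Sum>x\<in>PiE {..n} (\<lambda>_. UNIV).
      expectation (\<lambda>\<omega>. h x * indicator {\<omega> \<in> space M. (\<forall>k\<le>n. X k \<omega> = x k) \<and> Q \<omega>} \<omega>))"
    by (intro Bochner_Integration.integral_sum integrable_mult_right integrable_real_indicator)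
      (auto simp: less_top[symmetric])
  finally show ?thesis by simp
qed

text \<open>The Markov property tested against functionals of the past, in place of a conditional
  expectation of \<open>g\<close> at time n + 1.\<close>

lemma expectation_Suc:
  assumes "depends_upto n h"
  shows "expectation (\<lambda>\<omega>. h (\<lambda>k. X k \<omega>) * g (X (Suc n) \<omega>)) =
    expectation (\<lambda>\<omega>. h (\<lambda>k. X k \<omega>) * measure_pmf.expectation (P (X n \<omega>)) g)"
proof -
  let ?S = "PiE {..n} (\<lambda>_. UNIV :: 's set)"
  let ?I = "\<lambda>j. indicator {\<omega> \<in> space M. X (Suc n) \<omega> = j} :: 'a \<Rightarrow> real"
  have "expectation (\<lambda>\<omega>. h (\<lambda>k. X k \<omega>) * g (X (Suc n) \<omega>)) =
      expectation (\<lambda>\<omega>. \<Sum>j\<in>UNIV. g j * (h (\<lambda>k. X k \<omega>) * ?I j \<omega>))"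
    by (intro Bochner_Integration.integral_cong[OF refl])
      (simp add: indicator_def of_bool_def if_distrib[of "\<lambda>x. _ * x"] cong: if_cong)
  also have "\<dots> = (\<Sum>j\<in>UNIV. g j * expectation (\<lambda>\<omega>. h (\<lambda>k. X k \<omega>) * ?I j \<omega>))"
    by (subst Bochner_Integration.integral_sum)
      (auto intro!: integrable_mult_right integrable_real_mult_indicator
        integrable_path_function[OF assms])
  also have "\<dots> = (\<Sum>j\<in>UNIV. g j * (\<Sum>x\<in>?S. h x *
      (\<P>(\<omega> in M. \<forall>k\<le>n. X k \<omega> = x k) * pmf (P (x n)) j)))"
    by (subst expectation_path_function_indicator[OF assms]) (auto simp: prob_path_Suc)
  also have "\<dots> = (\<Sum>x\<in>?S. h x * measure_pmf.expectation (P (x n)) g *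
      \<P>(\<omega> in M. \<forall>k\<le>n. X k \<omega> = x k))"
    by (subst integral_measure_pmf[of UNIV])
      (simp_all add: sum_distrib_left sum_distrib_right mult_ac sum.swap[of _ UNIV])
  also have "\<dots> = expectation (\<lambda>\<omega>. h (\<lambda>k. X k \<omega>) *
      measure_pmf.expectation (P (X n \<omega>)) g * indicator {\<omega> \<in> space M. True} \<omega>)"
    by (subst expectation_path_function_indicator[
        of n "\<lambda>x. h x * measure_pmf.expectation (P (x n)) g" "\<lambda>_. True"])
      (auto intro!: depends_upto_mult assms depends_upto_coordinate)
  also have "\<dots> = expectation (\<lambda>\<omega>. h (\<lambda>k. X k \<omega>) * measure_pmf.expectation (P (X n \<omega>)) g)"
    by (intro Bochner_Integration.integral_cong) auto
  finally show ?thesis .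
qed

text \<open>The last step is absorbed into \<open>g\<close>, which becomes its one-step average;
  hence the induction over arbitrary \<open>g\<close>.\<close>

lemma expectation_add:
  assumes "depends_upto n h"
  shows "expectation (\<lambda>\<omega>. h (\<lambda>k. X k \<omega>) * g (X (n + t) \<omega>)) =
    expectation (\<lambda>\<omega>. h (\<lambda>k. X k \<omega>) * measure_pmf.expectation (nstep_law P (X n \<omega>) t) g)"
proof (induction t arbitrary: g)
  case (Suc t)
  have "expectation (\<lambda>\<omega>. h (\<lambda>k. X k \<omega>) * g (X (n + Suc t) \<omega>)) =
      expectation (\<lambda>\<omega>. h (\<lambda>k. X k \<omega>) * measure_pmf.expectation (P (X (n + t) \<omega>)) g)"
    using expectation_Suc[OF depends_upto_mono[OF assms, of "n + t"], of g] by simp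
  then show ?case
    by (simp add: Suc.IH[of "\<lambda>k. measure_pmf.expectation (P k) g"] expectation_bind_finite)
qed simp

end

section \<open>Exponential moments along one residue class\<close>

text \<open>Hoeffding's lemma for a variable with range in an interval of length 1, centred at its
  own mean, gives \<open>s\<^sup>2 / 8\<close>; moving the centre to \<open>\<mu>\<close> costs at
  most \<open>s * \<delta>\<close> since s \<ge> 0.\<close>

lemma hoeffding_mgf:
  fixes p :: "'s::finite pmf" and f :: "'s \<Rightarrow> real"
  assumes f: "\<And>i. f i \<in> {0..1}" and s: "s \<ge> 0"
    and mean: "measure_pmf.expectation p f \<le> \<mu> + \<delta>"
  shows "measure_pmf.expectation p (\<lambda>i. exp (s * (f i - \<mu>))) \<le> exp (s * \<delta> + s\<^sup>2 / 8)"
proof (cases "s = 0")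
  case False
  with s have s: "s > 0" by simp
  interpret interval_bounded_random_variable "measure_pmf p" f 0 1
    by unfold_locales (use f in auto)
  let ?m = "measure_pmf.expectation p f"
  have int: "integrable (measure_pmf p) g" for g :: "'s \<Rightarrow> real"
    by (rule integrable_measure_pmf_finite) simp
  have "ennreal (measure_pmf.expectation p (\<lambda>i. exp (s * (f i - ?m)))) =
      (\<integral>\<^sup>+ i. exp (s * (f i - ?m)) \<partial>p)"
    by (rule nn_integral_eq_integral[symmetric]) (auto intro: int)
  also have "\<dots> \<le> ennreal (exp (s\<^sup>2 * (1 - 0)\<^sup>2 / 8))"
    by (rule Hoeffdings_lemma_nn_integral) (fact s)
  finally have *: "measure_pmf.expectation p (\<lambda>i. exp (s * (f i - ?m))) \<le> exp (s\<^sup>2 / 8)"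
    by simp
  have "measure_pmf.expectation p (\<lambda>i. exp (s * (f i - \<mu>))) =
      exp (s * (?m - \<mu>)) * measure_pmf.expectation p (\<lambda>i. exp (s * (f i - ?m)))"
    by (simp add: algebra_simps flip: exp_add Bochner_Integration.integral_mult_right_zero)
  also have "\<dots> \<le> exp (s * \<delta>) * exp (s\<^sup>2 / 8)"
    using s mean by (intro mult_mono * iffD2[OF exp_le_cancel_iff] mult_left_mono
      Bochner_Integration.integral_nonneg) auto
  finally show ?thesis by (simp add: exp_add)
qed simp

context markov_chain
begin

text \<open>Terms are peeled off from the last: it lies \<open>T\<close> steps after a time by which
  all earlier ones are determined, so its factor is bounded uniformly in the past.\<close>

lemma mgf_subsampled_sum:
  fixes f :: "'s \<Rightarrow> real" and s \<mu> \<delta> :: real and a T m :: nat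
  assumes f: "\<And>i. f i \<in> {0..1}" and s: "s \<ge> 0"
    and mean: "\<And>i. measure_pmf.expectation (nstep_law P i T) f \<le> \<mu> + \<delta>"
    and a: "a \<ge> T"
  shows "expectation (\<lambda>\<omega>. exp (s * (\<Sum>j<m. f (X (a + j * T) \<omega>) - \<mu>)))
    \<le> exp (m * (s * \<delta> + s\<^sup>2 / 8))"
proof (induction m)
  case 0
  then show ?case by (simp add: prob_space)
next
  case (Suc m)
  define h where "h x = exp (s * (\<Sum>j<m. f (x (a + j * T)) - \<mu>))" for x :: "nat \<Rightarrow> 's"
  \<comment> \<open>The time \<open>T\<close> steps before the last term; a \<ge> T keeps the
    subtraction exact even for m = 0.\<close>
  define n where "n = a + m * T - T"
  define g where "g i = exp (s * (f i - \<mu>))" for i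
  have le: "a + j * T \<le> n" if "j < m" for j
  proof -
    have "j * T + T \<le> m * T"
      using mult_le_mono1[of "Suc j" m T] that by simp
    then show ?thesis by (simp add: n_def)
  qed
  have dep: "depends_upto n h"
    unfolding h_def using le
    by (intro depends_upto_comp[where g = "\<lambda>x. exp (s * x)"] depends_upto_sum
        depends_upto_coordinate[where g = "\<lambda>x. f x - \<mu>"]) auto
  have n: "n + T = a + m * T"
    using a by (simp add: n_def)
  have "expectation (\<lambda>\<omega>. exp (s * (\<Sum>j<Suc m. f (X (a + j * T) \<omega>) - \<mu>))) =
      expectation (\<lambda>\<omega>. h (\<lambda>k. X k \<omega>) * g (X (n + T) \<omega>))"
    by (simp add: h_def g_def n distrib_left flip: exp_add)
  also have "\<dots> = expectation (\<lambda>\<omega>. h (\<lambda>k. X k \<omega>) * measure_pmf.expectation (nstep_law P (X n \<omega>) T) g)"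
    by (rule expectation_add[OF dep])
  also have "\<dots> \<le> expectation (\<lambda>\<omega>. h (\<lambda>k. X k \<omega>) * exp (s * \<delta> + s\<^sup>2 / 8))"
  proof (rule integral_mono)
    show "integrable M (\<lambda>\<omega>. h (\<lambda>k. X k \<omega>) * measure_pmf.expectation (nstep_law P (X n \<omega>) T) g)"
      using integrable_path_function[OF depends_upto_mult[OF dep depends_upto_coordinate[of n n]]]
      by simp
    show "integrable M (\<lambda>\<omega>. h (\<lambda>k. X k \<omega>) * exp (s * \<delta> + s\<^sup>2 / 8))"
      using integrable_path_function[OF dep] by simp
    show "h (\<lambda>k. X k \<omega>) * measure_pmf.expectation (nstep_law P (X n \<omega>) T) g
        \<le> h (\<lambda>k. X k \<omega>) * exp (s * \<delta> + s\<^sup>2 / 8)" for \<omega>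
      unfolding g_def by (intro mult_left_mono hoeffding_mgf f s mean) (simp add: h_def)
  qed
  also have "\<dots> = expectation (\<lambda>\<omega>. h (\<lambda>k. X k \<omega>)) * exp (s * \<delta> + s\<^sup>2 / 8)"
    by simp
  also have "\<dots> \<le> exp (m * (s * \<delta> + s\<^sup>2 / 8)) * exp (s * \<delta> + s\<^sup>2 / 8)"
    using Suc.IH by (intro mult_right_mono) (auto simp: h_def)
  also have "\<dots> = exp (Suc m * (s * \<delta> + s\<^sup>2 / 8))"
    by (simp add: distrib_right mult.commute flip: exp_add)
  finally show ?case .
qed

end

section \<open>Splitting into residue classes, and the Chernoff tail\<close>

text \<open>Identifies \<open>Suc ((L - 1 - k) div T)\<close> as the number of points k, k + T, k +
  2T, ... below \<open>L\<close>.\<close>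

lemma residue_class_index:
  assumes "T \<ge> 1" "k < L"
  shows "j < Suc ((L - 1 - k) div T) \<longleftrightarrow> k + j * T < L"
proof -
  have "j < Suc ((L - 1 - k) div T) \<longleftrightarrow> j * T \<le> L - 1 - k"
    using assms(1) by (simp add: less_Suc_eq_le less_eq_div_iff_mult_less_eq)
  with assms(2) show ?thesis by linarith
qed

text \<open>Division with remainder is the bijection. Offsets stop at \<open>min T L\<close> because
  those from \<open>L\<close> on would start empty classes.\<close>

lemma sum_residue_classes:
  fixes g :: "nat \<Rightarrow> real"
  assumes T: "T \<ge> 1"
  shows "(\<Sum>i<L. g i) = (\<Sum>k<min T L. \<Sum>j<Suc ((L - 1 - k) div T). g (k + j * T))"
proof -
  have "(\<Sum>k<min T L. \<Sum>j<Suc ((L - 1 - k) div T). g (k + j * T)) =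
      (\<Sum>(k, j)\<in>(SIGMA k:{..<min T L}. {..<Suc ((L - 1 - k) div T)}). g (k + j * T))"
    by (rule sum.Sigma) auto
  also have "\<dots> = (\<Sum>i<L. g i)"
  proof (rule sum.reindex_bij_witness[of _ "\<lambda>i. (i mod T, i div T)" "\<lambda>(k, j). k + j * T"])
    fix i assume i: "i \<in> {..<L}"
    have "i mod T < L"
      using i by (simp add: le_less_trans[OF mod_less_eq_dividend])
    then show "(i mod T, i div T) \<in> (SIGMA k:{..<min T L}. {..<Suc ((L - 1 - k) div T)})"
      using T i residue_class_index[of T "i mod T" L "i div T"]
      by simp
  next
    fix x assume "x \<in> (SIGMA k:{..<min T L}. {..<Suc ((L - 1 - k) div T)})"
    then obtain k j where x: "x = (k, j)" "k < T" "k < L" "j < Suc ((L - 1 - k) div T)"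
      by auto
    then show "(case x of (k, j) \<Rightarrow> k + j * T) \<in> {..<L}"
      using residue_class_index[OF T x(3)] by simp
    show "((case x of (k, j) \<Rightarrow> k + j * T) mod T, (case x of (k, j) \<Rightarrow> k + j * T) div T) = x"
      using x by simp
  qed (use T in auto)
  finally show ?thesis ..
qed

context markov_chain
begin

text \<open>The residue classes are weighted by their share of the \<open>L\<close> times in Jensen's inequality; every
  nonempty class contains at least \<open>L / (2 T)\<close> of them.\<close>

lemma mgf_sum:
  fixes f :: "'s \<Rightarrow> real" and s \<mu> \<delta> :: real and a T L :: nat
  assumes f: "\<And>i. f i \<in> {0..1}" and s: "s \<ge> 0"
    and mean: "\<And>i. measure_pmf.expectation (nstep_law P i T) f \<le> \<mu> + \<delta>"
    and a: "a \<ge> T" and T: "T \<ge> 1" and L: "L \<ge> 1"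
  shows "expectation (\<lambda>\<omega>. exp (s * (\<Sum>i<L. f (X (a + i) \<omega>) - \<mu>)))
    \<le> exp (L * (s * \<delta> + s\<^sup>2 * T / 4))"
proof -
  define m where "m k = Suc ((L - 1 - k) div T)" for k
  define K where "K = {..<min T L}"
  define S where "S k \<omega> = (\<Sum>j<m k. f (X (a + k + j * T) \<omega>) - \<mu>)" for k \<omega>
  \<comment> \<open>Chosen so that the Jensen weight \<open>m k / L\<close> times \<open>t k\<close>
    is \<open>s\<close>.\<close>
  define t where "t k = s * L / m k" for k
  define B where "B = exp (L * (s * \<delta> + s\<^sup>2 * T / 4))"
  have m_pos: "real (m k) > 0" for k
    by (simp add: m_def)
  have L_pos: "real L > 0"
    using L by simp
  have m_ge: "real L \<le> 2 * T * m k" if "k \<in> K" for k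
  proof -
    have k: "k < T" "k < L" using that by (auto simp: K_def)
    \<comment> \<open>The first point past the class is at least \<open>L\<close>, and its offset
      satisfies k < T \<le> \<open>m k * T\<close>; hence L \<le>
      \<open>2 * T * m k\<close>.\<close>
    have "\<not> k + m k * T < L"
      using residue_class_index[OF T k(2), of "m k"] by (simp add: m_def)
    moreover have "T \<le> m k * T"
      by (simp add: m_def)
    ultimately have "L \<le> 2 * T * m k"
      unfolding mult.assoc mult.commute[of T] using k by linarith
    then show ?thesis
      by (rule of_nat_mono)
  qed
  have sum_S: "(\<Sum>i<L. f (X (a + i) \<omega>) - \<mu>) = (\<Sum>k\<in>K. S k \<omega>)" for \<omega>
    by (subst sum_residue_classes[OF T]) (simp add: K_def S_def m_def add.assoc)
  have sum_m: "(\<Sum>k\<in>K. m k / L) = 1"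
    using sum_residue_classes[OF T, of "\<lambda>_. 1" L] L_pos
    by (simp add: K_def m_def flip: sum_divide_distrib)
  have "K \<noteq> {}"
    using T L by (simp add: K_def lessThan_empty_iff)
  have jensen: "exp (s * (\<Sum>k\<in>K. S k \<omega>)) \<le> (\<Sum>k\<in>K. m k / L * exp (t k * S k \<omega>))" for \<omega>
  proof -
    have "m k / L * (t k * S k \<omega>) = s * S k \<omega>" for k
      using m_pos[of k] L_pos by (simp add: t_def)
    then have "s * (\<Sum>k\<in>K. S k \<omega>) = (\<Sum>k\<in>K. (m k / L) *\<^sub>R (t k * S k \<omega>))"
      by (simp add: sum_distrib_left)
    then show ?thesis
      using convex_on_sum[OF _ \<open>K \<noteq> {}\<close> exp_convex sum_m, of "\<lambda>k. t k * S k \<omega>"]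
      by (simp add: K_def)
  qed
  have int: "integrable M (\<lambda>\<omega>. exp (c * (\<Sum>i\<in>A. f (X (r i) \<omega>) - \<mu>)))"
    if "finite A" for c r and A :: "nat set"
  proof (rule integrable_path_function[where n = "Max (r ` A)"])
    show "depends_upto (Max (r ` A)) (\<lambda>x. exp (c * (\<Sum>i\<in>A. f (x (r i)) - \<mu>)))"
      using that
      by (intro depends_upto_comp[where g = "\<lambda>x. exp (c * x)"] depends_upto_sum
          depends_upto_coordinate[where g = "\<lambda>x. f x - \<mu>"]) auto
  qed
  have int_S: "integrable M (\<lambda>\<omega>. exp (t k * S k \<omega>))" for k
    unfolding S_def by (rule int) simp
  have class_bound: "expectation (\<lambda>\<omega>. exp (t k * S k \<omega>)) \<le> B" if "k \<in> K" for k
  proof -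
    have "expectation (\<lambda>\<omega>. exp (t k * S k \<omega>)) \<le> exp (m k * (t k * \<delta> + (t k)\<^sup>2 / 8))"
      unfolding S_def using s by (intro mgf_subsampled_sum f mean) (use a in \<open>simp_all add: t_def\<close>)
    \<comment> \<open>The linear term no longer depends on the class; only the quadratic one sees
      its size.\<close>
    also have "m k * (t k * \<delta> + (t k)\<^sup>2 / 8) = L * (s * \<delta> + s\<^sup>2 * (L / m k) / 8)"
      using m_pos[of k] by (simp add: t_def field_simps power2_eq_square)
    also have "exp \<dots> \<le> B"
    proof -
      have "L / m k \<le> 2 * T"
        using m_ge[OF that] m_pos[of k] by (simp add: divide_le_eq)
      then have "s\<^sup>2 * (L / m k) / 8 \<le> s\<^sup>2 * (2 * T) / 8"
        by (intro divide_right_mono mult_left_mono) auto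
      also have "\<dots> = s\<^sup>2 * T / 4"
        by simp
      finally show ?thesis
        unfolding B_def by (intro iffD2[OF exp_le_cancel_iff] mult_left_mono add_left_mono) auto
    qed
    finally show ?thesis .
  qed
  have "expectation (\<lambda>\<omega>. exp (s * (\<Sum>i<L. f (X (a + i) \<omega>) - \<mu>)))
      \<le> expectation (\<lambda>\<omega>. \<Sum>k\<in>K. m k / L * exp (t k * S k \<omega>))"
    by (intro integral_mono int Bochner_Integration.integrable_sum integrable_mult_right int_S)
      (simp_all only: sum_S jensen finite_lessThan)
  also have "\<dots> = (\<Sum>k\<in>K. m k / L * expectation (\<lambda>\<omega>. exp (t k * S k \<omega>)))"
    by (subst Bochner_Integration.integral_sum) (auto intro!: integrable_mult_right int_S)
  also have "\<dots> \<le> (\<Sum>k\<in>K. m k / L * B)"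
    by (intro sum_mono mult_left_mono class_bound) auto
  also have "\<dots> = B"
    by (simp only: sum_m mult_1_left flip: sum_distrib_right)
  finally show ?thesis by (simp add: B_def)
qed

lemma prob_sum_ge:
  fixes f :: "'s \<Rightarrow> real" and \<epsilon> \<mu> :: real and a T L :: nat
  assumes f: "\<And>i. f i \<in> {0..1}" and \<epsilon>: "\<epsilon> > 0"
    and mean: "\<And>i. measure_pmf.expectation (nstep_law P i T) f \<le> \<mu> + \<epsilon> / 2"
    and a: "a \<ge> T" and T: "T \<ge> 1" and L: "L \<ge> 1"
  shows "\<P>(\<omega> in M. (\<Sum>i<L. f (X (a + i) \<omega>) - \<mu>) \<ge> L * \<epsilon>) \<le> exp (- (\<epsilon>\<^sup>2 * (L / T) / 4))"
proof -
  \<comment> \<open>Minimises the Chernoff exponent \<open>- s * L * \<epsilon> + L * (s *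
    \<epsilon> / 2 + s\<^sup>2 * T / 4)\<close>, with value
    \<open>- L * \<epsilon>\<^sup>2 / (4 * T)\<close>.\<close>
  define s where "s = \<epsilon> / T"
  have s: "s > 0"
    using \<epsilon> T by (simp add: s_def)
  define Z where "Z \<omega> = (\<Sum>i<L. f (X (a + i) \<omega>) - \<mu>)" for \<omega>
  have int: "integrable M (\<lambda>\<omega>. exp (s * Z \<omega>))"
    unfolding Z_def
    by (intro integrable_path_function[of "a + L" "\<lambda>x. exp (s * (\<Sum>i<L. f (x (a + i)) - \<mu>))"]
        depends_upto_comp[where g = "\<lambda>x. exp (s * x)"] depends_upto_sum
        depends_upto_coordinate[where g = "\<lambda>x. f x - \<mu>"]) auto
  have "\<P>(\<omega> in M. Z \<omega> \<ge> L * \<epsilon>) \<le> exp (- s * (L * \<epsilon>)) * (\<integral>\<omega>\<in>space M. exp (s * Z \<omega>) \<partial>M)"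
    by (intro Chernoff_ineq_ge s)
      (simp_all only: set_integrable_def integrable_mult_indicator int sets.top)
  also have "(\<integral>\<omega>\<in>space M. exp (s * Z \<omega>) \<partial>M) = expectation (\<lambda>\<omega>. exp (s * Z \<omega>))"
    using int by (rule set_integral_space)
  also have "exp (- s * (L * \<epsilon>)) * \<dots> \<le> exp (- s * (L * \<epsilon>)) * exp (L * (s * (\<epsilon> / 2) + s\<^sup>2 * T / 4))"
    unfolding Z_def using s by (intro mult_left_mono mgf_sum f mean a T L) auto
  also have "\<dots> = exp (- (\<epsilon>\<^sup>2 * (L / T) / 4))"
    using T by (simp add: s_def field_simps power2_eq_square flip: exp_add)
  finally show ?thesis by (simp add: Z_def)
qed

end

section \<open>Coverage of the interval from the two tails\<close>

theorem theorem2: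
  fixes P :: "'s::finite \<Rightarrow> 's pmf"
    and \<pi> \<pi>\<^sub>0 :: "'s pmf"
    and f :: "'s \<Rightarrow> real"
    and M :: "'a measure"
    and X :: "nat \<Rightarrow> 'a \<Rightarrow> 's"
    and \<alpha> \<epsilon>\<^sub>N :: real
    and N :: nat
  assumes "irreducible_chain P"
    and "aperiodic_chain P"
    and "stationary_distribution \<pi> P"
    and "reversible_chain \<pi> P"
    and "\<And>i. f i \<in> {0..1}"
    and "\<alpha> \<in> {0<..<1}"
    and "markov_chain M P \<pi>\<^sub>0 X"
    and "N > 0"
    and "\<epsilon>\<^sub>N > 0"
    and "\<epsilon>\<^sub>N \<in> r_fun P \<pi> f N -` {8 * ln (2 / \<alpha>)..}"
  shows "confidence_interval M (1 - \<alpha>) (measure_pmf.expectation \<pi> f)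
           (func_interval P \<pi> f X N \<epsilon>\<^sub>N)"
proof -
  interpret markov_chain M P \<pi>\<^sub>0 X by fact
  define T where "T = f_mixing_time P \<pi> f (\<epsilon>\<^sub>N / 2)"
  define \<mu> where "\<mu> = measure_pmf.expectation \<pi> f"
  define L where "L = N - T"
  define q where "q = exp (- (\<epsilon>\<^sub>N\<^sup>2 * (L / T) / 4))"
  have T: "T \<ge> 1" and mix: "f_dist f (nstep_law P i T) \<pi> \<le> \<epsilon>\<^sub>N / 2" for i
    unfolding T_def by (rule f_mixing_time_props[OF assms(1-4)], use assms(9) in simp)+
  have r: "\<epsilon>\<^sub>N\<^sup>2 * (N / T - 1) \<ge> 8 * ln (2 / \<alpha>)"
    using assms(10) by (simp add: r_fun_def T_def)
  have ln_pos: "ln (2 / \<alpha>) > 0"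
    using assms(6) by simp
  \<comment> \<open>Positivity forces T < N, so \<open>L\<close> is the true number of averaged
    terms and the denominator is positive.\<close>
  then have "\<epsilon>\<^sub>N\<^sup>2 * (N / T - 1) > 0"
    using r by linarith
  then have "real N / T > 1"
    using assms(9) by (simp add: zero_less_mult_iff)
  then have "T < N"
    using T by (simp add: less_divide_eq)
  then have L: "L \<ge> 1" and L_real: "real L = real N - real T"
    by (simp_all add: L_def)
  have q: "2 * q \<le> \<alpha>"
  proof -
    have "N / T - 1 = L / T"
      using T by (simp add: L_real diff_divide_distrib)
    \<comment> \<open>The constant 8 makes the exponent at most
      \<open>- 2 * ln (2 / \<alpha>)\<close>; half of that suffices for each tail to be at most
      \<open>\<alpha> / 2\<close>.\<close>
    then have "- (\<epsilon>\<^sub>N\<^sup>2 * (L / T) / 4) \<le> - ln (2 / \<alpha>)"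
      using r ln_pos by simp
    then have "q \<le> exp (- ln (2 / \<alpha>))"
      by (simp add: q_def)
    then show ?thesis
      using assms(6) by (simp add: exp_minus)
  qed
  have int: "integrable (measure_pmf p) f" for p
    by (rule integrable_measure_pmf_finite) simp
  define U where "U = {\<omega> \<in> space M. (\<Sum>i<L. f (X (Suc T + i) \<omega>) - \<mu>) \<ge> L * \<epsilon>\<^sub>N}"
  \<comment> \<open>The lower tail of \<open>f\<close>, written as an upper tail of
    \<open>1 - f\<close> so that \<open>prob_sum_ge\<close> covers both. Both sums start at
    \<open>Suc T\<close>, the first time in the interval's average.\<close>
  define V where "V = {\<omega> \<in> space M. (\<Sum>i<L. (1 - f (X (Suc T + i) \<omega>)) - (1 - \<mu>)) \<ge> L * \<epsilon>\<^sub>N}"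
  define G where "G = {\<omega> \<in> space M. \<mu> \<in> func_interval P \<pi> f X N \<epsilon>\<^sub>N \<omega>}"
  have [measurable]: "(\<lambda>\<omega>. f (X n \<omega>)) \<in> borel_measurable M" for n
    by (rule measurable_compose[OF measurable_X]) simp
  have U: "prob U \<le> q"
    unfolding U_def q_def
  proof (rule prob_sum_ge[where f = f])
    show "measure_pmf.expectation (nstep_law P i T) f \<le> \<mu> + \<epsilon>\<^sub>N / 2" for i
      using mix[of i] unfolding f_dist_def \<mu>_def[symmetric] abs_le_iff by simp
  qed (use assms(5,9) L T in auto)
  have V: "prob V \<le> q"
    unfolding V_def q_def
  proof (rule prob_sum_ge[where f = "\<lambda>i. 1 - f i"])
    show "measure_pmf.expectation (nstep_law P i T) (\<lambda>i. 1 - f i) \<le> 1 - \<mu> + \<epsilon>\<^sub>N / 2" for i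
      using mix[of i] unfolding f_dist_def \<mu>_def[symmetric] abs_le_iff by (simp add: int)
  qed (use assms(5,9) L T in auto)
  have cover: "space M - G \<subseteq> U \<union> V"
  proof
    fix \<omega> assume "\<omega> \<in> space M - G"
    then have \<omega>: "\<omega> \<in> space M" "\<mu> \<notin> func_interval P \<pi> f X N \<epsilon>\<^sub>N \<omega>"
      by (auto simp: G_def)
    define A where "A = (\<Sum>i<L. f (X (Suc T + i) \<omega>))"
    have "(\<Sum>n = T + 1..N. f (X n \<omega>)) = A"
      unfolding A_def
      by (rule sum.reindex_bij_witness[of _ "\<lambda>i. Suc T + i" "\<lambda>n. n - Suc T"])
        (use \<open>T < N\<close> in \<open>auto simp: L_def\<close>)
    with \<omega>(2) have "A / L - \<mu> > \<epsilon>\<^sub>N \<or> \<mu> - A / L > \<epsilon>\<^sub>N"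
      by (auto simp: func_interval_def pm_interval_def Let_def T_def[symmetric] L_real)
    then have "A - L * \<mu> \<ge> L * \<epsilon>\<^sub>N \<or> L * \<mu> - A \<ge> L * \<epsilon>\<^sub>N"
      using L by (auto simp: field_simps)
    then show "\<omega> \<in> U \<union> V"
      using \<omega>(1) by (auto simp: U_def V_def A_def sum_subtractf)
  qed
  have [measurable]: "G \<in> events" "U \<in> events" "V \<in> events"
    unfolding G_def U_def V_def func_interval_def pm_interval_def Let_def atLeastAtMost_iff
    by measurable
  have "1 - prob G = prob (space M - G)"
    by (simp add: prob_compl)
  also have "\<dots> \<le> prob (U \<union> V)"
    by (rule finite_measure_mono[OF cover]) simp
  also have "\<dots> \<le> prob U + prob V"
    by (rule measure_Un_le) simp_all
  finally have "1 - \<alpha> \<le> prob G"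
    using U V q by linarith
  then show ?thesis
    by (simp add: confidence_interval_def G_def \<mu>_def)
qed

end
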